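(* Let $d$ be even and let $f$ be a homogeneous multilinear $n$-variate polynomial of degree $d$ with real coefficients. Then \[\frac{\Lambda(f)}{\|f\|_2}\le2^{O(d)}\,\frac{n^{d/2}}{d^{d/2}}.\]
   Context: $\|f\|_2:=\sup_{\|x\|_2=1}|f(x)|$. Multilinear means every monomial with non-zero coefficient has all exponents at most 1. A matrix representation of $f$ is a symmetric $M\in\mathbb{R}^{[n]^{d/2}\times[n]^{d/2}}$ with $(x^{\otimes d/2})^TMx^{\otimes d/2}=f(x)$ for all $x$, and $\Lambda(f):=\inf\{\sup_{\|z\|_2=1}z^TMz:\ M\text{ a matrix representation of }f\}$. *)

theory Defs
  imports "HOL-Analysis.L2_Norm" "HOL-Library.Poly_Mapping"
begin

text \<open>
  A real multivariate polynomial is a finitely supported map from monomials to coefficients, a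
  monomial being the finitely supported map from variable indices to exponents. The variables of
  an \<open>n\<close>-variate polynomial are indexed by \<open>{..<n}\<close>, and a vector in \<open>\<real>\<^sup>n\<close> is a function
  \<open>nat \<Rightarrow> real\<close> of which only the values on \<open>{..<n}\<close> are used.
\<close>

type_synonym monomial = "nat \<Rightarrow>\<^sub>0 nat"

type_synonym mpoly = "monomial \<Rightarrow>\<^sub>0 real"

definition mpoly_eval :: "mpoly \<Rightarrow> (nat \<Rightarrow> real) \<Rightarrow> real" where
  "mpoly_eval f x =
    (\<Sum>m \<in> Poly_Mapping.keys f. Poly_Mapping.lookup f m *
      (\<Prod>i \<in> Poly_Mapping.keys m. x i ^ Poly_Mapping.lookup m i))"

definition n_variate :: "nat \<Rightarrow> mpoly \<Rightarrow> bool" where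
  "n_variate n f \<longleftrightarrow> (\<forall>m \<in> Poly_Mapping.keys f. Poly_Mapping.keys m \<subseteq> {..<n})"

text \<open>The zero polynomial counts as homogeneous of every degree.\<close>

definition homogeneous :: "nat \<Rightarrow> mpoly \<Rightarrow> bool" where
  "homogeneous d f \<longleftrightarrow>
    (\<forall>m \<in> Poly_Mapping.keys f. (\<Sum>i \<in> Poly_Mapping.keys m. Poly_Mapping.lookup m i) = d)"

definition multilinear :: "mpoly \<Rightarrow> bool" where
  "multilinear f \<longleftrightarrow> (\<forall>m \<in> Poly_Mapping.keys f. \<forall>i. Poly_Mapping.lookup m i \<le> 1)"

definition mpoly_norm2 :: "nat \<Rightarrow> mpoly \<Rightarrow> real" where
  "mpoly_norm2 n f = (SUP x \<in> {x. L2_set x {..<n} = 1}. \<bar>mpoly_eval f x\<bar>)"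

text \<open>
  The multi-indices \<open>[n]\<^sup>k\<close> are the lists of length \<open>k\<close> over \<open>{..<n}\<close>. Vectors and matrices indexed
  by them are functions on lists of which only the values at multi-indices are used.
\<close>

definition multi_indices :: "nat \<Rightarrow> nat \<Rightarrow> nat list set" where
  "multi_indices n k = {I. set I \<subseteq> {..<n} \<and> length I = k}"

definition tensor_power :: "(nat \<Rightarrow> real) \<Rightarrow> nat list \<Rightarrow> real" where
  "tensor_power x I = (\<Prod>i\<leftarrow>I. x i)"

definition quad_form :: "'i set \<Rightarrow> ('i \<Rightarrow> 'i \<Rightarrow> real) \<Rightarrow> ('i \<Rightarrow> real) \<Rightarrow> real" where
  "quad_form S M z = (\<Sum>I\<in>S. \<Sum>J\<in>S. z I * M I J * z J)"

definition matrix_representation ::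
  "nat \<Rightarrow> nat \<Rightarrow> mpoly \<Rightarrow> (nat list \<Rightarrow> nat list \<Rightarrow> real) \<Rightarrow> bool" where
  "matrix_representation n d f M \<longleftrightarrow>
    (\<forall>I \<in> multi_indices n (d div 2). \<forall>J \<in> multi_indices n (d div 2). M I J = M J I) \<and>
    (\<forall>x. quad_form (multi_indices n (d div 2)) M (tensor_power x) = mpoly_eval f x)"

definition sup_quad_form :: "'i set \<Rightarrow> ('i \<Rightarrow> 'i \<Rightarrow> real) \<Rightarrow> real" where
  "sup_quad_form S M = (SUP z \<in> {z. L2_set z S = 1}. quad_form S M z)"

definition Lambda :: "nat \<Rightarrow> nat \<Rightarrow> mpoly \<Rightarrow> real" where
  "Lambda n d f =
    (INF M \<in> {M. matrix_representation n d f M}. sup_quad_form (multi_indices n (d div 2)) M)"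

end

theory Submission
  imports Defs "HOL-Combinatorics.Multiset_Permutations"
begin

text \<open>
  Spread each coefficient \<open>c\<^sub>S\<close> evenly over the \<open>d!\<close> orderings of \<open>S\<close>, cut in half. This symmetric
  matrix representation has squared Frobenius norm \<open>(\<Sum>\<^sub>S c\<^sub>S\<^sup>2) / d!\<close>, and the Frobenius norm bounds
  the quadratic form on the unit sphere. On the other hand the mean of \<open>f\<^sup>2\<close> over the sign vectors,
  which have length \<open>\<surd>n\<close>, is \<open>\<Sum>\<^sub>S c\<^sub>S\<^sup>2\<close>, so \<open>\<parallel>f\<parallel>\<^sub>2\<^sup>2 \<ge> (\<Sum>\<^sub>S c\<^sub>S\<^sup>2) / n\<^sup>d\<close>. The quotient is
  at most \<open>n\<^bsup>d/2\<^esup> / \<surd>(d!)\<close>, and \<open>d\<^sup>d \<le> 4\<^sup>d d!\<close>.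
\<close>

section \<open>A Stirling-type estimate\<close>

lemma power_self_le_fact: "real d ^ d \<le> 4 ^ d * fact d"
proof -
  have "real d ^ d / fact d \<le> exp (real d)"
  proof -
    have s: "(\<lambda>k. real d ^ k / fact k) sums exp (real d)"
      using exp_converges[of "real d"] by (simp add: field_simps)
    have "(\<Sum>k\<in>{d}. real d ^ k / fact k) \<le> exp (real d)"
      using sum_le_suminf[of "\<lambda>k. real d ^ k / fact k" "{d}"] s
      by (simp add: sums_iff)
    then show ?thesis by simp
  qed
  also have "\<dots> = exp 1 ^ d"
    by (simp flip: exp_of_nat_mult)
  \<comment> \<open>Already e \<le> 3; base 4 is chosen as a perfect square, so that its square root
    later gives \<open>2 ^ d\<close>.\<close>
  also have "\<dots> \<le> 4 ^ d"
    using exp_le by (intro power_mono) auto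
  finally show ?thesis
    by (simp add: field_simps)
qed

section \<open>Multi-indices and tensor powers\<close>

lemma multi_indices_finite [simp]: "finite (multi_indices n k)"
  unfolding multi_indices_def by (rule finite_lists_length_eq) simp

lemma bij_betw_append_multi_indices:
  "bij_betw (\<lambda>(I, J). I @ J) (multi_indices n k \<times> multi_indices n l) (multi_indices n (k + l))"
proof (rule bij_betwI[where g = "\<lambda>L. (take k L, drop k L)"])
  show "(\<lambda>L. (take k L, drop k L)) \<in>
      multi_indices n (k + l) \<rightarrow> multi_indices n k \<times> multi_indices n l"
    by (fastforce simp: multi_indices_def dest: in_set_takeD in_set_dropD)
qed (auto simp: multi_indices_def)

text \<open>Merges row and column index into one word, so quadratic forms and Frobenius norms become
  sums over single words.\<close>

lemma sum_multi_indices_append: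
  "(\<Sum>I\<in>multi_indices n k. \<Sum>J\<in>multi_indices n l. h (I @ J)) = sum h (multi_indices n (k + l))"
  using sum.reindex_bij_betw[OF bij_betw_append_multi_indices, of h n k l]
  by (simp add: sum.cartesian_product split_def)

lemma tensor_power_append: "tensor_power x (I @ J) = tensor_power x I * tensor_power x J"
  by (simp add: tensor_power_def)

lemma L2_set_times:
  "L2_set (\<lambda>(i, j). a i * b j) (A \<times> B) = L2_set a A * L2_set b B"
  by (simp add: L2_set_def real_sqrt_mult[symmetric] sum_product sum.cartesian_product
      power_mult_distrib split_def)

text \<open>Each tensor factor multiplies the norm by that of \<open>x\<close>. Hence tensor powers
  of unit vectors are unit test vectors for matrix representations.\<close>

lemma L2_set_tensor_power: "L2_set (tensor_power x) (multi_indices n k) = L2_set x {..<n} ^ k"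
proof (induction k)
  case 0
  have "multi_indices n 0 = {[]}"
    by (auto simp: multi_indices_def)
  then show ?case
    by (simp add: L2_set_def tensor_power_def)
next
  case (Suc k)
  have one: "L2_set (tensor_power x) (multi_indices n 1) = L2_set x {..<n}"
  proof -
    have "multi_indices n 1 = (\<lambda>i. [i]) ` {..<n}"
      by (auto simp: multi_indices_def length_Suc_conv)
    then show ?thesis
      by (simp add: L2_set_def sum.reindex inj_on_def tensor_power_def)
  qed
  have "L2_set (tensor_power x) (multi_indices n (1 + k)) =
      L2_set (tensor_power x) (multi_indices n 1) * L2_set (tensor_power x) (multi_indices n k)"
    unfolding L2_set_times[symmetric] unfolding L2_set_def
    by (simp only: sum_multi_indices_append[symmetric] sum.cartesian_product tensor_power_append split_def)
  then show ?case
    using Suc one by simp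
qed

section \<open>Frobenius bound for quadratic forms and for \<open>Lambda\<close>\<close>

lemma quad_form_le_frobenius:
  assumes "L2_set z S = 1"
  shows "quad_form S M z \<le> sqrt (\<Sum>I\<in>S. \<Sum>J\<in>S. (M I J)\<^sup>2)"
proof -
  have "quad_form S M z = (\<Sum>p\<in>S\<times>S. M (fst p) (snd p) * (case p of (i, j) \<Rightarrow> z i * z j))"
    by (simp add: quad_form_def sum.cartesian_product split_def mult_ac)
  also have "\<dots> \<le> (\<Sum>p\<in>S\<times>S. \<bar>M (fst p) (snd p)\<bar> * \<bar>case p of (i, j) \<Rightarrow> z i * z j\<bar>)"
    by (intro sum_mono) (metis abs_ge_self abs_mult)
  \<comment> \<open>Cauchy-Schwarz over pairs of indices; the second factor is the norm of the
    tensor square of \<open>z\<close>, which is 1.\<close>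
  also have "\<dots> \<le> L2_set (\<lambda>p. M (fst p) (snd p)) (S\<times>S) * L2_set (\<lambda>(i, j). z i * z j) (S\<times>S)"
    by (rule L2_set_mult_ineq)
  also have "\<dots> = sqrt (\<Sum>I\<in>S. \<Sum>J\<in>S. (M I J)\<^sup>2)"
    by (simp only: L2_set_times assms) (simp add: L2_set_def sum.cartesian_product split_def)
  finally show ?thesis .
qed

lemma L2_set_unit_vector: "finite A \<Longrightarrow> a \<in> A \<Longrightarrow> L2_set (\<lambda>i. if i = a then 1 else 0) A = 1"
  by (simp add: L2_set_def if_distrib[of "\<lambda>y. y\<^sup>2"] cong: if_cong)

lemma sup_quad_form_le_frobenius:
  assumes "finite S" "S \<noteq> {}"
  shows "sup_quad_form S M \<le> sqrt (\<Sum>I\<in>S. \<Sum>J\<in>S. (M I J)\<^sup>2)"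
  unfolding sup_quad_form_def
proof (rule cSUP_least)
  obtain a where "a \<in> S"
    using assms(2) by blast
  then have "(\<lambda>i. if i = a then 1 else 0) \<in> {z. L2_set z S = 1}"
    using assms(1) L2_set_unit_vector[of S a] by simp
  then show "{z. L2_set z S = 1} \<noteq> {}"
    by (metis empty_iff)
qed (simp add: quad_form_le_frobenius)

text \<open>The Frobenius norm bounds the values from above, so the real supremum dominates each of
  them.\<close>

lemma quad_form_le_sup_quad_form:
  assumes "L2_set z S = 1"
  shows "quad_form S M z \<le> sup_quad_form S M"
  unfolding sup_quad_form_def
  by (rule cSUP_upper) (use assms quad_form_le_frobenius in \<open>auto intro!: bdd_aboveI2\<close>)

lemma Lambda_le_frobenius:
  assumes "n \<ge> 1" "matrix_representation n d f M"
  shows "Lambda n d f \<le>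
    sqrt (\<Sum>I\<in>multi_indices n (d div 2). \<Sum>J\<in>multi_indices n (d div 2). (M I J)\<^sup>2)"
proof -
  let ?S = "multi_indices n (d div 2)"
  define x :: "nat \<Rightarrow> real" where "x = (\<lambda>i. if i = 0 then 1 else 0)"
  have x: "L2_set x {..<n} = 1"
    using assms L2_set_unit_vector[of "{..<n}" 0] by (simp add: x_def)
  \<comment> \<open>Lowering a real infimum to its value at \<open>M\<close> requires a common lower
    bound. Every representation takes the value of \<open>f\<close> at \<open>x\<close> on the unit
    vector \<open>tensor_power x\<close>, so this one value serves for all.\<close>
  have "bdd_below (sup_quad_form ?S ` {M. matrix_representation n d f M})"
  proof (rule bdd_belowI2)
    fix N assume "N \<in> {M. matrix_representation n d f M}"
    then show "mpoly_eval f x \<le> sup_quad_form ?S N"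
      using quad_form_le_sup_quad_form[of "tensor_power x" ?S N] x
      by (simp add: matrix_representation_def L2_set_tensor_power)
  qed
  then have "Lambda n d f \<le> sup_quad_form ?S M"
    unfolding Lambda_def using assms by (intro cINF_lower) auto
  also have "replicate (d div 2) 0 \<in> ?S"
    using assms by (auto simp: multi_indices_def)
  then have "sup_quad_form ?S M \<le> sqrt (\<Sum>I\<in>?S. \<Sum>J\<in>?S. (M I J)\<^sup>2)"
    by (intro sup_quad_form_le_frobenius) auto
  finally show ?thesis .
qed

section \<open>Multilinear monomials as sets of variables\<close>

lemma multilinear_lookup:
  assumes "multilinear f" "m \<in> Poly_Mapping.keys f"
  shows "Poly_Mapping.lookup m i = (if i \<in> Poly_Mapping.keys m then 1 else 0)"
proof -
  have "Poly_Mapping.lookup m i \<le> 1"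
    using assms by (simp add: multilinear_def)
  moreover have "Poly_Mapping.lookup m i = 0 \<longleftrightarrow> i \<notin> Poly_Mapping.keys m"
    by (simp add: in_keys_iff)
  ultimately show ?thesis
    by auto
qed

text \<open>All exponents are 0 or 1, so the support determines the monomial.\<close>

lemma multilinear_keys_inj:
  assumes "multilinear f"
  shows "inj_on Poly_Mapping.keys (Poly_Mapping.keys f)"
  by (intro inj_onI poly_mapping_eqI) (simp add: multilinear_lookup[OF assms])

lemma multilinear_mpoly_eval:
  assumes "multilinear f"
  shows "mpoly_eval f x =
    (\<Sum>m\<in>Poly_Mapping.keys f. Poly_Mapping.lookup f m * (\<Prod>i\<in>Poly_Mapping.keys m. x i))"
  unfolding mpoly_eval_def
  by (intro sum.cong refl arg_cong2[where f = "(*)"] prod.cong)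
    (simp add: multilinear_lookup[OF assms])

lemma multilinear_homogeneous_card:
  assumes "multilinear f" "homogeneous d f" "m \<in> Poly_Mapping.keys f"
  shows "card (Poly_Mapping.keys m) = d"
proof -
  have "(\<Sum>i\<in>Poly_Mapping.keys m. Poly_Mapping.lookup m i) = (\<Sum>i\<in>Poly_Mapping.keys m. 1)"
    by (intro sum.cong refl) (simp add: multilinear_lookup[OF assms(1,3)])
  then show ?thesis
    using assms by (simp add: homogeneous_def)
qed

section \<open>The symmetric coefficient tensor and its matrix\<close>

text \<open>For multilinear \<open>f\<close> at most one summand is nonzero, since distinct
  monomials have distinct supports; the sum avoids choosing that monomial. Words with a repeated
  index get 0.\<close>

definition spread_coeff :: "nat \<Rightarrow> mpoly \<Rightarrow> nat list \<Rightarrow> real" where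
  "spread_coeff d f L = (\<Sum>m\<in>Poly_Mapping.keys f.
    if L \<in> permutations_of_set (Poly_Mapping.keys m) then Poly_Mapping.lookup f m / fact d else 0)"

text \<open>Being an ordering of a set ignores the order of the letters; this makes the matrix
  symmetric.\<close>

lemma spread_coeff_append_commute: "spread_coeff d f (I @ J) = spread_coeff d f (J @ I)"
  by (simp add: spread_coeff_def permutations_of_set_def Un_commute Int_commute conj_ac
      cong: if_cong)

lemma sum_permutations_of_keys:
  assumes "n_variate n f" "homogeneous d f" "multilinear f" "m \<in> Poly_Mapping.keys f"
  shows "(\<Sum>L\<in>multi_indices n d.
    if L \<in> permutations_of_set (Poly_Mapping.keys m) then c else 0) = fact d * (c :: real)"
proof -
  let ?P = "permutations_of_set (Poly_Mapping.keys m)"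
  have card: "card (Poly_Mapping.keys m) = d"
    using assms multilinear_homogeneous_card by blast
  have "?P \<subseteq> multi_indices n d"
    using assms card
    by (auto simp: multi_indices_def permutations_of_set_def n_variate_def distinct_card[symmetric])
  then have "multi_indices n d \<inter> ?P = ?P"
    by blast
  then show ?thesis
    by (simp add: sum.If_cases card)
qed

text \<open>On each ordering of a support \<open>tensor_power\<close> is the monomial itself, and
  the \<open>fact d\<close> equal shares add up to its coefficient.\<close>

lemma sum_spread_coeff_tensor_power:
  assumes "n_variate n f" "homogeneous d f" "multilinear f"
  shows "(\<Sum>L\<in>multi_indices n d. spread_coeff d f L * tensor_power x L) = mpoly_eval f x"
proof -
  let ?P = "\<lambda>m. permutations_of_set (Poly_Mapping.keys m)"
  let ?X = "\<lambda>m. \<Prod>i\<in>Poly_Mapping.keys m. x i"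
  have "spread_coeff d f L * tensor_power x L =
      (\<Sum>m\<in>Poly_Mapping.keys f. if L \<in> ?P m then Poly_Mapping.lookup f m / fact d * ?X m else 0)" for L
    unfolding spread_coeff_def sum_distrib_right
    by (intro sum.cong refl)
      (auto simp: tensor_power_def permutations_of_set_def simp flip: prod.distinct_set_conv_list)
  then have "(\<Sum>L\<in>multi_indices n d. spread_coeff d f L * tensor_power x L) =
      (\<Sum>m\<in>Poly_Mapping.keys f. \<Sum>L\<in>multi_indices n d.
        if L \<in> ?P m then Poly_Mapping.lookup f m / fact d * ?X m else 0)"
    by (simp add: sum.swap[of _ "multi_indices n d"])
  also have "\<dots> = (\<Sum>m\<in>Poly_Mapping.keys f. Poly_Mapping.lookup f m * ?X m)"
    using assms by (intro sum.cong refl) (simp add: sum_permutations_of_keys)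
  also have "\<dots> = mpoly_eval f x"
    using assms by (simp add: multilinear_mpoly_eval)
  finally show ?thesis .
qed

text \<open>Orderings of different supports are disjoint, so squaring produces no cross terms; each
  monomial contributes \<open>fact d\<close> equal squares.\<close>

lemma sum_spread_coeff_squared:
  assumes "n_variate n f" "homogeneous d f" "multilinear f"
  shows "(\<Sum>L\<in>multi_indices n d. (spread_coeff d f L)\<^sup>2) =
    (\<Sum>m\<in>Poly_Mapping.keys f. (Poly_Mapping.lookup f m)\<^sup>2) / fact d"
proof -
  let ?P = "\<lambda>m. permutations_of_set (Poly_Mapping.keys m)"
  have sq: "(spread_coeff d f L)\<^sup>2 =
      (\<Sum>m\<in>Poly_Mapping.keys f. if L \<in> ?P m then (Poly_Mapping.lookup f m / fact d)\<^sup>2 else 0)" for L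
  proof (cases "\<exists>m\<in>Poly_Mapping.keys f. L \<in> ?P m")
    case True
    then obtain m where m: "m \<in> Poly_Mapping.keys f" "L \<in> ?P m" by blast
    have eq: "L \<in> ?P m' \<longleftrightarrow> m' = m" if "m' \<in> Poly_Mapping.keys f" for m'
      using m that multilinear_keys_inj[OF assms(3)]
      by (auto simp: permutations_of_set_def dest: inj_onD)
    \<comment> \<open>Kept general in \<open>g\<close> to serve both for the coefficients and for
      their squares.\<close>
    have sum_eq: "(\<Sum>m'\<in>Poly_Mapping.keys f. if L \<in> ?P m' then g m' else 0) = g m"
      for g :: "monomial \<Rightarrow> real"
      using m(1) by (simp add: eq cong: sum.cong)
    show ?thesis
      by (simp add: spread_coeff_def sum_eq)
  next
    case False
    then show ?thesis
      by (simp add: spread_coeff_def)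
  qed
  have "(\<Sum>L\<in>multi_indices n d. (spread_coeff d f L)\<^sup>2) =
      (\<Sum>m\<in>Poly_Mapping.keys f. fact d * (Poly_Mapping.lookup f m / fact d)\<^sup>2)"
    unfolding sq using assms
    by (subst sum.swap) (intro sum.cong refl, simp add: sum_permutations_of_keys)
  also have "\<dots> = (\<Sum>m\<in>Poly_Mapping.keys f. (Poly_Mapping.lookup f m)\<^sup>2) / fact d"
    by (simp add: sum_divide_distrib power2_eq_square)
  finally show ?thesis .
qed

lemma Lambda_le_sqrt_sum_squares:
  assumes "n \<ge> 1" "even d" "n_variate n f" "homogeneous d f" "multilinear f"
  shows "Lambda n d f \<le> sqrt ((\<Sum>m\<in>Poly_Mapping.keys f. (Poly_Mapping.lookup f m)\<^sup>2) / fact d)"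
proof -
  have d: "d div 2 + d div 2 = d"
    using \<open>even d\<close> by auto
  \<comment> \<open>The tensor is cut in the middle, which is possible because \<open>d\<close> is
    even; its entries, and so its Frobenius norm, are unchanged.\<close>
  define M where "M = (\<lambda>I J. spread_coeff d f (I @ J))"
  have "quad_form (multi_indices n (d div 2)) M (tensor_power x) = mpoly_eval f x" for x
    using sum_multi_indices_append[of "\<lambda>L. spread_coeff d f L * tensor_power x L" n "d div 2" "d div 2"]
      sum_spread_coeff_tensor_power[OF assms(3-5), of x]
    by (simp add: quad_form_def M_def d tensor_power_append mult_ac)
  then have "matrix_representation n d f M"
    by (simp add: matrix_representation_def M_def spread_coeff_append_commute)
  from Lambda_le_frobenius[OF \<open>n \<ge> 1\<close> this] show ?thesis
    using sum_multi_indices_append[of "\<lambda>L. (spread_coeff d f L)\<^sup>2" n "d div 2" "d div 2"]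
      sum_spread_coeff_squared[OF assms(3-5)]
    by (simp add: M_def d)
qed

section \<open>Averaging over sign vectors\<close>

lemma sum_signs_characters:
  assumes "A \<subseteq> {..<n}" "B \<subseteq> {..<n}"
  shows "(\<Sum>e\<in>{..<n} \<rightarrow>\<^sub>E {-1, 1}. (\<Prod>i\<in>A. e i) * (\<Prod>i\<in>B. e i)) =
    (if A = B then 2 ^ n else (0::real))"
proof -
  \<comment> \<open>Orthogonality of Walsh characters, coordinate by coordinate:
    \<open>g i t\<close> is 1, \<open>t\<close> or the square of \<open>t\<close> as
    \<open>i\<close> lies in neither, one or both sets. Summed over both signs this is 2, 0 or
    2.\<close>
  define g :: "nat \<Rightarrow> real \<Rightarrow> real"
    where "g i t = (if i \<in> A then t else 1) * (if i \<in> B then t else 1)" for i t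
  have restrict: "(\<Prod>i\<in>C. e i) = (\<Prod>i<n. if i \<in> C then e i else 1)"
    if "C \<subseteq> {..<n}" for C and e :: "nat \<Rightarrow> real"
    using that by (simp add: prod.If_cases Int_absorb1)
  have "(\<Sum>e\<in>{..<n} \<rightarrow>\<^sub>E {-1, 1}. (\<Prod>i\<in>A. e i) * (\<Prod>i\<in>B. e i)) =
      (\<Sum>e\<in>{..<n} \<rightarrow>\<^sub>E {-1, 1}. \<Prod>i<n. g i (e i))"
    by (simp add: restrict[OF assms(1)] restrict[OF assms(2)] g_def prod.distrib)
  also have "\<dots> = (\<Prod>i<n. \<Sum>t\<in>{-1, 1}. g i t)"
    by (rule prod_sum_PiE[symmetric]) auto
  also have "\<dots> = (if A = B then 2 ^ n else 0)"
  proof (cases "A = B")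
    case True
    have "(\<Sum>t\<in>{-1, 1}. g i t) = 2" for i
      by (simp add: g_def True)
    then show ?thesis
      using True by simp
  next
    case False
    then obtain i where "i \<in> A \<longleftrightarrow> i \<notin> B" by blast
    then have "i < n" "(\<Sum>t\<in>{-1, 1}. g i t) = 0"
      using assms by (auto simp: g_def)
    then show ?thesis
      using False by (metis finite_lessThan lessThan_iff prod_zero)
  qed
  finally show ?thesis .
qed

text \<open>Parseval's identity: after expanding the square, orthogonality removes all cross
  terms.\<close>

lemma sum_signs_mpoly_eval_squared:
  assumes "n_variate n f" "multilinear f"
  shows "(\<Sum>e\<in>{..<n} \<rightarrow>\<^sub>E {-1, 1}. (mpoly_eval f e)\<^sup>2) =
    2 ^ n * (\<Sum>m\<in>Poly_Mapping.keys f. (Poly_Mapping.lookup f m)\<^sup>2)"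
proof -
  let ?E = "{..<n} \<rightarrow>\<^sub>E {-1, 1 :: real}"
  let ?K = "Poly_Mapping.keys f" and ?c = "Poly_Mapping.lookup f"
  let ?X = "\<lambda>m e. \<Prod>i\<in>Poly_Mapping.keys m. e i :: real"
  have "(\<Sum>e\<in>?E. (mpoly_eval f e)\<^sup>2) =
      (\<Sum>e\<in>?E. \<Sum>m\<in>?K. \<Sum>m'\<in>?K. ?c m * ?c m' * (?X m e * ?X m' e))"
    by (simp add: multilinear_mpoly_eval[OF assms(2)] power2_eq_square sum_product mult_ac)
  also have "\<dots> = (\<Sum>m\<in>?K. \<Sum>m'\<in>?K. ?c m * ?c m' * (\<Sum>e\<in>?E. ?X m e * ?X m' e))"
    by (subst sum.swap, intro sum.cong refl, subst sum.swap) (simp add: sum_distrib_left)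
  also have "\<dots> = (\<Sum>m\<in>?K. \<Sum>m'\<in>?K. if m = m' then 2 ^ n * (?c m)\<^sup>2 else 0)"
  proof (intro sum.cong refl)
    fix m m' assume m: "m \<in> ?K" "m' \<in> ?K"
    then have "Poly_Mapping.keys m = Poly_Mapping.keys m' \<longleftrightarrow> m = m'"
      using multilinear_keys_inj[OF assms(2)] by (auto dest: inj_onD)
    then show "?c m * ?c m' * (\<Sum>e\<in>?E. ?X m e * ?X m' e) = (if m = m' then 2 ^ n * (?c m)\<^sup>2 else 0)"
      using assms(1) m by (simp add: sum_signs_characters n_variate_def power2_eq_square)
  qed
  also have "\<dots> = 2 ^ n * (\<Sum>m\<in>?K. (?c m)\<^sup>2)"
    by (simp add: sum_distrib_left)
  finally show ?thesis .
qed

text \<open>Some sign vector reaches at least the mean of the squared values.\<close>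

lemma exists_signs_mpoly_eval_squared:
  assumes "n_variate n f" "multilinear f"
  obtains e where "\<And>i. i < n \<Longrightarrow> \<bar>e i\<bar> = 1"
    and "(\<Sum>m\<in>Poly_Mapping.keys f. (Poly_Mapping.lookup f m)\<^sup>2) \<le> (mpoly_eval f e)\<^sup>2"
proof -
  let ?E = "{..<n} \<rightarrow>\<^sub>E {-1, 1 :: real}"
  let ?s = "\<Sum>m\<in>Poly_Mapping.keys f. (Poly_Mapping.lookup f m)\<^sup>2"
  have "card ?E = 2 ^ n"
    by (simp add: card_PiE numeral_2_eq_2)
  then have E: "?E \<noteq> {}" "finite ?E"
    by (auto intro: finite_PiE)
  have "\<exists>e\<in>?E. ?s \<le> (mpoly_eval f e)\<^sup>2"
  proof (rule ccontr)
    assume "\<not> ?thesis"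
    then have "(\<Sum>e\<in>?E. (mpoly_eval f e)\<^sup>2) < (\<Sum>e\<in>?E. ?s)"
      using E by (intro sum_strict_mono) auto
    also have "\<dots> = 2 ^ n * ?s"
      using \<open>card ?E = 2 ^ n\<close> by simp
    finally show False
      by (simp add: sum_signs_mpoly_eval_squared[OF assms])
  qed
  then obtain e where e: "e \<in> ?E" "?s \<le> (mpoly_eval f e)\<^sup>2"
    by blast
  have "\<bar>e i\<bar> = 1" if "i < n" for i
    using PiE_mem[OF e(1), of i] that by auto
  then show ?thesis
    using e(2) that by blast
qed

section \<open>Lower bound for the norm of the polynomial\<close>

lemma multilinear_homogeneous_scale:
  assumes "homogeneous d f" "multilinear f"
  shows "mpoly_eval f (\<lambda>i. t * x i) = t ^ d * mpoly_eval f x"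
  using assms
  by (simp add: multilinear_mpoly_eval prod.distrib multilinear_homogeneous_card[OF assms(2,1)]
      sum_distrib_left mult_ac)

text \<open>Coordinates of a unit vector have absolute value at most 1, so the sum of absolute
  coefficients bounds the values and the supremum is genuine.\<close>

lemma abs_mpoly_eval_le_norm2:
  assumes "n_variate n f" "L2_set x {..<n} = 1"
  shows "\<bar>mpoly_eval f x\<bar> \<le> mpoly_norm2 n f"
  unfolding mpoly_norm2_def
proof (rule cSUP_upper)
  show "bdd_above ((\<lambda>x. \<bar>mpoly_eval f x\<bar>) ` {x. L2_set x {..<n} = 1})"
  proof (rule bdd_aboveI2)
    fix x assume "x \<in> {x. L2_set x {..<n} = 1}"
    then have "\<bar>x i\<bar> \<le> 1" if "i < n" for i
      using member_le_L2_set[of "{..<n}" i "\<lambda>i. \<bar>x i\<bar>"] that by (simp add: L2_set_def)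
    then have "\<bar>\<Prod>i\<in>Poly_Mapping.keys m. x i ^ Poly_Mapping.lookup m i\<bar> \<le> 1"
      if "m \<in> Poly_Mapping.keys f" for m
      using that assms(1) unfolding abs_prod power_abs n_variate_def
      by (intro prod_le_1) (auto intro!: power_le_one)
    then show "\<bar>mpoly_eval f x\<bar> \<le> (\<Sum>m\<in>Poly_Mapping.keys f. \<bar>Poly_Mapping.lookup f m\<bar> * 1)"
      unfolding mpoly_eval_def
      by (intro order_trans[OF sum_abs] sum_mono) (simp only: abs_mult, intro mult_left_mono, auto)
  qed
qed (use assms in simp)

lemma sqrt_sum_squares_le_norm2:
  assumes "n \<ge> 1" "even d" "n_variate n f" "homogeneous d f" "multilinear f"
  shows "sqrt (\<Sum>m\<in>Poly_Mapping.keys f. (Poly_Mapping.lookup f m)\<^sup>2)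
    \<le> real n ^ (d div 2) * mpoly_norm2 n f"
proof -
  obtain e where e: "\<And>i. i < n \<Longrightarrow> \<bar>e i\<bar> = 1"
    and s: "(\<Sum>m\<in>Poly_Mapping.keys f. (Poly_Mapping.lookup f m)\<^sup>2) \<le> (mpoly_eval f e)\<^sup>2"
    using exists_signs_mpoly_eval_squared[OF assms(3,5)] by blast
  \<comment> \<open>A sign vector has length \<open>sqrt n\<close>; scaling it to the unit sphere
    costs \<open>sqrt n ^ d\<close> by homogeneity.\<close>
  define x where "x = (\<lambda>i. (1 / sqrt n) * e i)"
  have "(x i)\<^sup>2 = 1 / n" if "i < n" for i
    using e[OF that] by (simp add: x_def power_mult_distrib power_divide abs_square_eq_1)
  then have "L2_set x {..<n} = 1"
    using \<open>n \<ge> 1\<close> by (simp add: L2_set_def)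
  then have le: "\<bar>mpoly_eval f x\<bar> \<le> mpoly_norm2 n f"
    by (rule abs_mpoly_eval_le_norm2[OF assms(3)])
  have "sqrt (real n) ^ d = real n ^ (d div 2)"
    using \<open>even d\<close> by (auto elim!: evenE simp: power_mult)
  then have "\<bar>mpoly_eval f e\<bar> = real n ^ (d div 2) * \<bar>mpoly_eval f x\<bar>"
    using \<open>n \<ge> 1\<close> unfolding x_def multilinear_homogeneous_scale[OF assms(4,5)]
    by (simp add: power_divide abs_mult)
  also have "\<dots> \<le> real n ^ (d div 2) * mpoly_norm2 n f"
    using le by (intro mult_left_mono) auto
  finally show ?thesis
    using real_sqrt_le_mono[OF s] by simp
qed

section \<open>Combining the two bounds\<close>

lemma Lambda_div_norm2_le:
  assumes "n \<ge> 1" "even d" "n_variate n f" "homogeneous d f" "multilinear f"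
  shows "Lambda n d f / mpoly_norm2 n f \<le> 2 ^ d * (real n ^ (d div 2) / real d ^ (d div 2))"
proof -
  define s where "s = sqrt (\<Sum>m\<in>Poly_Mapping.keys f. (Poly_Mapping.lookup f m)\<^sup>2)"
  have "0 \<le> s"
    by (simp add: s_def sum_nonneg)
  have lower: "s \<le> real n ^ (d div 2) * mpoly_norm2 n f"
    using sqrt_sum_squares_le_norm2[OF assms] by (simp add: s_def)
  have "0 < real n ^ (d div 2)"
    using \<open>n \<ge> 1\<close> by simp
  then have "0 \<le> mpoly_norm2 n f"
    using lower \<open>0 \<le> s\<close> by (smt (verit) mult_pos_neg)
  \<comment> \<open>For \<open>d = 0\<close> this is \<open>0 ^ 0 = 1\<close>.\<close>
  have pos: "0 < real d ^ (d div 2)"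
    by (cases d) auto
  have "real d ^ (d div 2) = sqrt (real d ^ d)"
    using \<open>even d\<close> by (auto elim!: evenE simp: power_mult power_mult_distrib real_sqrt_power)
  also have "\<dots> \<le> sqrt (4 ^ d * fact d)"
    by (intro real_sqrt_le_mono power_self_le_fact)
  also have "\<dots> = 2 ^ d * sqrt (fact d)"
    by (simp add: real_sqrt_mult real_sqrt_power)
  finally have stirling: "real d ^ (d div 2) \<le> 2 ^ d * sqrt (fact d)" .
  have "Lambda n d f \<le> s / sqrt (fact d)"
    using Lambda_le_sqrt_sum_squares[OF assms] by (simp add: s_def real_sqrt_divide)
  also have "\<dots> \<le> s * (2 ^ d / real d ^ (d div 2))"
    using mult_left_mono[OF stirling \<open>0 \<le> s\<close>] pos by (simp add: field_simps)
  also have "\<dots> \<le> real n ^ (d div 2) * mpoly_norm2 n f * (2 ^ d / real d ^ (d div 2))"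
    using lower by (rule mult_right_mono) simp
  finally have upper: "Lambda n d f \<le> 2 ^ d * (real n ^ (d div 2) / real d ^ (d div 2)) * mpoly_norm2 n f"
    by (simp add: mult_ac)
  show ?thesis
  \<comment> \<open>If the norm vanishes, the quotient is 0 by the convention for division by
    zero.\<close>
  proof (cases "mpoly_norm2 n f = 0")
    case False
    then show ?thesis
      using upper \<open>0 \<le> mpoly_norm2 n f\<close> by (subst pos_divide_le_eq) auto
  qed simp
qed

theorem theorem5p16:
  "\<exists>C::real. C > 0 \<and>
    (\<forall>(n::nat) (d::nat) (f::mpoly).
      n \<ge> 1 \<longrightarrow> even d \<longrightarrow> n_variate n f \<longrightarrow> homogeneous d f \<longrightarrow> multilinear f \<longrightarrow>
      Lambda n d f / mpoly_norm2 n f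
        \<le> 2 powr (C * real d) * (real n ^ (d div 2) / real d ^ (d div 2)))"
  \<comment> \<open>\<open>C = 1\<close>, because the explicit factor is
    \<open>2 ^ d\<close>.\<close>
  using Lambda_div_norm2_le by (intro exI[of _ 1]) (simp add: powr_realpow)

end
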